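(* For each step size $s>0$, let $\{\mathbf{u}^n\}_{n=0}^\infty\subset U$ be a sequence (which may depend on $s$) with $d_t\mathbf{u}^0=\mathbf{0}$ and $B(\mathbf{u}^0,\mathbf{u}^0)=\mathbf{u}_c$, such that the BDF-$4$ linearized constraint $B(\dot{\mathbf{u}}^n,\hat{\mathbf{u}}^n)=0$ holds for every $n\ge4$, and the BDF-$p$ version holds at $n=p$ for $p=1,2,3$. Then there is a constant $C>0$ independent of $s$ and $N$ such that for all $N\ge4$, $$\|B(\mathbf{u}^N,\mathbf{u}^N)-\mathbf{u}_c\|_Z\le C\Big(s^6\sum_{n=3}^N\|d_t^3\mathbf{u}^n\|_U^2+s^4\max_{1\le n\le N-1}\|d_t^2\mathbf{u}^n\|_U^2\Big).$$ Moreover, if there is a constant $C_0>0$ independent of $s$ and $N$ with $$\sum_{n=3}^Ns^2\|d_t^3\mathbf{u}^n\|_U^2\le C_0\quad\text{and}\quad\max_{1\le n\le N-1}\|d_t^2\mathbf{u}^n\|_U^2\le C_0,$$ then there is a constant $C'>0$ independent of $s$ and $N$ such that $\|B(\mathbf{u}^N,\mathbf{u}^N)-\mathbf{u}_c\|_Z\le C's^4$.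
   Context: $U$ is a real Hilbert space, $Z$ is a normed function space, $B:U\times U\to Z$ is a symmetric bilinear operator with $\|B(\mathbf{v},\mathbf{v})\|_Z\le c_Z\|\mathbf{v}\|_U^2$ for all $\mathbf{v}\in U$, and $\mathbf{u}_c\in Z$ is given. The BDF-$p$ version of the linearized constraint at index $n$ is $B(\dot{\mathbf{u}}^n,\hat{\mathbf{u}}^n)=0$ with: $p=1$: $\dot{\mathbf{u}}^n=(\mathbf{u}^n-\mathbf{u}^{n-1})/s$, $\hat{\mathbf{u}}^n=\mathbf{u}^{n-1}$; $p=2$: $\dot{\mathbf{u}}^n=\frac1s(\frac32\mathbf{u}^n-2\mathbf{u}^{n-1}+\frac12\mathbf{u}^{n-2})$, $\hat{\mathbf{u}}^n=2\mathbf{u}^{n-1}-\mathbf{u}^{n-2}$; $p=3$: $\dot{\mathbf{u}}^n=\frac1s(\frac{11}6\mathbf{u}^n-3\mathbf{u}^{n-1}+\frac32\mathbf{u}^{n-2}-\frac13\mathbf{u}^{n-3})$, $\hat{\mathbf{u}}^n=3\mathbf{u}^{n-1}-3\mathbf{u}^{n-2}+\mathbf{u}^{n-3}$; $p=4$: $\dot{\mathbf{u}}^n=\frac1s(\frac{25}{12}\mathbf{u}^n-4\mathbf{u}^{n-1}+3\mathbf{u}^{n-2}-\frac43\mathbf{u}^{n-3}+\frac14\mathbf{u}^{n-4})$, $\hat{\mathbf{u}}^n=4\mathbf{u}^{n-1}-6\mathbf{u}^{n-2}+4\mathbf{u}^{n-3}-\mathbf{u}^{n-4}$. Backward differences: $d_t\mathbf{u}^n=(\mathbf{u}^n-\mathbf{u}^{n-1})/s$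 for $n\ge1$, $d_t\mathbf{u}^0$ is the prescribed initial velocity, and $d_t^j\mathbf{u}^n=(d_t^{j-1}\mathbf{u}^n-d_t^{j-1}\mathbf{u}^{n-1})/s$ for $j\ge2$. *)

theory Defs
  imports "HOL-Analysis.Analysis"
begin

text \<open>
  Backward difference \<open>d\<^sub>t\<^sup>j u\<^sup>n\<close> with step size \<open>s\<close> and prescribed initial velocity
  \<open>v0 = d\<^sub>t u\<^sup>0\<close>. The differences \<open>d\<^sub>t\<^sup>j u\<^sup>0\<close> with \<open>j \<ge> 2\<close> have no meaning and are left
  unspecified; \<open>d\<^sub>t\<^sup>j u\<^sup>n\<close> involves one of them only if \<open>1 \<le> n \<le> j - 2\<close>.
\<close>
fun bdiff :: "real \<Rightarrow> 'a::real_vector \<Rightarrow> (nat \<Rightarrow> 'a) \<Rightarrow> nat \<Rightarrow> nat \<Rightarrow> 'a" where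
  "bdiff s v0 u 0 n = u n"
| "bdiff s v0 u (Suc 0) 0 = v0"
| "bdiff s v0 u (Suc (Suc j)) 0 = undefined"
| "bdiff s v0 u (Suc j) (Suc n) = (bdiff s v0 u j (Suc n) - bdiff s v0 u j n) /\<^sub>R s"

text \<open>
  In the next three definitions only \<open>p \<in> {1, 2, 3, 4}\<close> and \<open>n \<ge> p\<close> are meaningful, so that
  the natural number subtractions are never truncated.
\<close>
definition bdf_dot :: "nat \<Rightarrow> real \<Rightarrow> (nat \<Rightarrow> 'a::real_vector) \<Rightarrow> nat \<Rightarrow> 'a" where
  "bdf_dot p s u n = (1 / s) *\<^sub>R
     (if p = 1 then u n - u (n - 1)
      else if p = 2 then (3/2) *\<^sub>R u n - 2 *\<^sub>R u (n - 1) + (1/2) *\<^sub>R u (n - 2)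
      else if p = 3 then (11/6) *\<^sub>R u n - 3 *\<^sub>R u (n - 1) + (3/2) *\<^sub>R u (n - 2)
        - (1/3) *\<^sub>R u (n - 3)
      else if p = 4 then (25/12) *\<^sub>R u n - 4 *\<^sub>R u (n - 1) + 3 *\<^sub>R u (n - 2)
        - (4/3) *\<^sub>R u (n - 3) + (1/4) *\<^sub>R u (n - 4)
      else undefined)"

definition bdf_hat :: "nat \<Rightarrow> (nat \<Rightarrow> 'a::real_vector) \<Rightarrow> nat \<Rightarrow> 'a" where
  "bdf_hat p u n =
     (if p = 1 then u (n - 1)
      else if p = 2 then 2 *\<^sub>R u (n - 1) - u (n - 2)
      else if p = 3 then 3 *\<^sub>R u (n - 1) - 3 *\<^sub>R u (n - 2) + u (n - 3)
      else if p = 4 then 4 *\<^sub>R u (n - 1) - 6 *\<^sub>R u (n - 2) + 4 *\<^sub>R u (n - 3) - u (n - 4)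
      else undefined)"

definition bdf_constraint ::
  "('a::real_vector \<Rightarrow> 'a \<Rightarrow> 'b::real_vector) \<Rightarrow> nat \<Rightarrow> real \<Rightarrow> (nat \<Rightarrow> 'a) \<Rightarrow> nat \<Rightarrow> bool" where
  "bdf_constraint B p s u n \<longleftrightarrow> B (bdf_dot p s u n) (bdf_hat p u n) = 0"

end

theory Submission
  imports Defs
begin

text \<open>
  Write \<open>b n = B (u n) (u n)\<close>, \<open>E n\<close> and \<open>F n\<close> for the second and third undivided backward
  differences of \<open>u\<close>, and \<open>D\<close>, \<open>H\<close> for the undivided BDF-4 derivative and the extrapolation.
  Since \<open>D\<close> is exact on polynomials of degree 4 and \<open>H\<close> on those of degree 3, the quadratic form
  \<open>D b - 2 B (D u) (H u)\<close> has no products of differences of total order at most 4; the product of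
  orders 1 and 4 happens to cancel as well. What remains equals
  \<open>-2 (B (E (n - 1)) (E (n - 1)) - B (E (n - 2)) (E (n - 2)))\<close> plus a quadratic
  form in \<open>F n\<close> and \<open>F (n - 1)\<close>. Under the constraint \<open>D b\<close> is this remainder. Dividing out the
  factor \<open>\<zeta> - 1\<close> of the characteristic polynomial of \<open>D\<close>, that is, summing over \<open>n\<close>, telescopes the
  \<open>E\<close> part and leaves a recurrence for \<open>b\<close> with characteristic polynomial
  \<open>25 \<zeta>\<^sup>3 - 23 \<zeta>\<^sup>2 + 13 \<zeta> - 3\<close>, whose roots lie inside the unit disc. The starting
  steps are expanded in the same way, the zero initial velocity making \<open>u 1 - u 0\<close> a second difference.
\<close>

section \<open>Exact identities behind the linearized constraints\<close>

lemmas bilinear_expand =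
  bilinear_ladd bilinear_radd bilinear_lsub bilinear_rsub bilinear_lmul bilinear_rmul

lemma bdf_constraint_unscaled:
  assumes "bilinear B" and "s \<noteq> 0"
  shows "bdf_constraint B p s u n \<longleftrightarrow> B (bdf_dot p 1 u n) (bdf_hat p u n) = 0"
  using assms unfolding bdf_constraint_def bdf_dot_def
  by (simp add: bilinear_lmul)

context
  fixes B :: "'u::real_vector \<Rightarrow> 'u \<Rightarrow> 'z::real_normed_vector"
  assumes B: "bilinear B" and sym: "\<And>v w. B v w = B w v"
begin

lemma bdf1_constraint_expansion:
  assumes "s \<noteq> 0" and "bdf_constraint B 1 s u 1"
  shows "B (u 1) (u 1) - B (u 0) (u 0) = B (u 1 - u 0) (u 1 - u 0)"
proof -
  have "B (u 1 - u 0) (u 0) = 0"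
    using assms by (simp add: bdf_constraint_unscaled[OF B] bdf_dot_def bdf_hat_def)
  then show ?thesis
    by (simp add: bilinear_expand[OF B] sym[of "u 0" "u (Suc 0)"])
qed

text \<open>A discrete product rule with exact remainder. Doubling clears the denominators and the
  product rule gives another 2, hence \<open>4 *\<^sub>R B ?D ?H\<close> in the proof.\<close>

lemma bdf2_constraint_expansion:
  assumes "s \<noteq> 0" and "bdf_constraint B 2 s u 2"
  shows "3 *\<^sub>R B (u 2) (u 2) - 4 *\<^sub>R B (u 1) (u 1) + B (u 0) (u 0) =
    3 *\<^sub>R B (u 2 - 2 *\<^sub>R u 1 + u 0) (u 2 - 2 *\<^sub>R u 1 + u 0)"
proof -
  let ?D = "(3/2) *\<^sub>R u 2 - 2 *\<^sub>R u 1 + (1/2) *\<^sub>R u 0" and ?H = "2 *\<^sub>R u 1 - u 0"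
  let ?E = "u 2 - 2 *\<^sub>R u 1 + u 0"
  have "B ?D ?H = 0"
    using assms by (simp add: bdf_constraint_unscaled[OF B] bdf_dot_def bdf_hat_def)
  moreover have "3 *\<^sub>R B (u 2) (u 2) - 4 *\<^sub>R B (u 1) (u 1) + B (u 0) (u 0) =
      4 *\<^sub>R B ?D ?H + 3 *\<^sub>R B ?E ?E"
    \<comment> \<open>Concrete instances of \<open>sym\<close> put each mixed product into one
      order; the identity is then linear in the products.\<close>
    unfolding bilinear_expand[OF B] sym[of "u 0" "u 1"] sym[of "u 0" "u 2"] sym[of "u 1" "u 2"]
    by norm
  ultimately show ?thesis by simp
qed

lemma bdf3_constraint_expansion:
  fixes u :: "nat \<Rightarrow> 'u"
  assumes "s \<noteq> 0" and "bdf_constraint B 3 s u 3"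
  defines "E \<equiv> u 2 - 2 *\<^sub>R u 1 + u 0" and "F \<equiv> u 3 - 3 *\<^sub>R u 2 + 3 *\<^sub>R u 1 - u 0"
  shows "11 *\<^sub>R B (u 3) (u 3) - 18 *\<^sub>R B (u 2) (u 2) + 9 *\<^sub>R B (u 1) (u 1) - 2 *\<^sub>R B (u 0) (u 0) =
    11 *\<^sub>R B F F - 9 *\<^sub>R B E E"
proof -
  let ?D = "(11/6) *\<^sub>R u 3 - 3 *\<^sub>R u 2 + (3/2) *\<^sub>R u 1 - (1/3) *\<^sub>R u 0"
    and ?H = "3 *\<^sub>R u 2 - 3 *\<^sub>R u 1 + u 0"
  have "B ?D ?H = 0"
    using assms(1,2) by (simp add: bdf_constraint_unscaled[OF B] bdf_dot_def bdf_hat_def)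
  moreover have "11 *\<^sub>R B (u 3) (u 3) - 18 *\<^sub>R B (u 2) (u 2) + 9 *\<^sub>R B (u 1) (u 1)
      - 2 *\<^sub>R B (u 0) (u 0) = 12 *\<^sub>R B ?D ?H + (11 *\<^sub>R B F F - 9 *\<^sub>R B E E)"
    unfolding E_def F_def bilinear_expand[OF B] sym[of "u 0" "u 1"] sym[of "u 0" "u 2"]
      sym[of "u 1" "u 2"] sym[of "u 0" "u 3"] sym[of "u 1" "u 3"] sym[of "u 2" "u 3"]
    by norm
  ultimately show ?thesis by simp
qed

text \<open>The squares of \<open>E\<close> form a difference of consecutive terms. Bounded one by
  one they would add up over all steps; telescoped, only the two ends remain and a maximum
  suffices.\<close>

lemma bdf4_constraint_expansion:
  fixes u :: "nat \<Rightarrow> 'u"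
  assumes "s \<noteq> 0" and "bdf_constraint B 4 s u (n + 4)"
  defines "E \<equiv> \<lambda>k. u (k + 2) - 2 *\<^sub>R u (k + 1) + u k"
    and "F \<equiv> \<lambda>k. u (k + 3) - 3 *\<^sub>R u (k + 2) + 3 *\<^sub>R u (k + 1) - u k"
  shows "25 *\<^sub>R B (u (n + 4)) (u (n + 4)) - 48 *\<^sub>R B (u (n + 3)) (u (n + 3))
      + 36 *\<^sub>R B (u (n + 2)) (u (n + 2)) - 16 *\<^sub>R B (u (n + 1)) (u (n + 1)) + 3 *\<^sub>R B (u n) (u n) =
    24 *\<^sub>R B (E n) (E n) - 24 *\<^sub>R B (E (n + 1)) (E (n + 1))
      + 25 *\<^sub>R B (F (n + 1)) (F (n + 1)) - 50 *\<^sub>R B (F (n + 1)) (F n) - 15 *\<^sub>R B (F n) (F n)"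
proof -
  define x0 x1 x2 x3 x4
    where x: "x0 = u n" "x1 = u (n + 1)" "x2 = u (n + 2)" "x3 = u (n + 3)" "x4 = u (n + 4)"
  have EF: "E n = x2 - 2 *\<^sub>R x1 + x0" "E (n + 1) = x3 - 2 *\<^sub>R x2 + x1"
    "F n = x3 - 3 *\<^sub>R x2 + 3 *\<^sub>R x1 - x0" "F (n + 1) = x4 - 3 *\<^sub>R x3 + 3 *\<^sub>R x2 - x1"
    unfolding E_def F_def x by (simp_all add: numeral_eq_Suc)
  let ?D = "(25/12) *\<^sub>R x4 - 4 *\<^sub>R x3 + 3 *\<^sub>R x2 - (4/3) *\<^sub>R x1 + (1/4) *\<^sub>R x0"
    and ?H = "4 *\<^sub>R x3 - 6 *\<^sub>R x2 + 4 *\<^sub>R x1 - x0"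
  have "B ?D ?H = 0"
    using assms(1,2)
    by (simp add: bdf_constraint_unscaled[OF B] bdf_dot_def bdf_hat_def x numeral_3_eq_3)
  moreover have "25 *\<^sub>R B x4 x4 - 48 *\<^sub>R B x3 x3 + 36 *\<^sub>R B x2 x2 - 16 *\<^sub>R B x1 x1 + 3 *\<^sub>R B x0 x0 =
      24 *\<^sub>R B ?D ?H + (24 *\<^sub>R B (E n) (E n) - 24 *\<^sub>R B (E (n + 1)) (E (n + 1))
      + 25 *\<^sub>R B (F (n + 1)) (F (n + 1)) - 50 *\<^sub>R B (F (n + 1)) (F n) - 15 *\<^sub>R B (F n) (F n))"
    unfolding EF bilinear_expand[OF B] sym[of x0 x1] sym[of x0 x2] sym[of x0 x3]
      sym[of x0 x4] sym[of x1 x2] sym[of x1 x3] sym[of x1 x4] sym[of x2 x3] sym[of x2 x4]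
      sym[of x3 x4]
    by norm
  ultimately show ?thesis unfolding x by simp
qed

end

section \<open>Polarization and stability of the cubic recurrence\<close>

text \<open>Polarization carries the diagonal bound over to mixed products such as
  \<open>B (F (n + 1)) (F n)\<close>; the parallelogram law evaluates the squares.\<close>

lemma bilinear_quadratic_bound:
  fixes B :: "'u::real_inner \<Rightarrow> 'u \<Rightarrow> 'z::real_normed_vector"
  assumes B: "bilinear B" and sym: "\<And>v w. B v w = B w v"
    and bound: "\<And>v. norm (B v v) \<le> c * (norm v)\<^sup>2"
  shows "norm (B v w) \<le> c * ((norm v)\<^sup>2 + (norm w)\<^sup>2) / 2"
proof -
  have "4 *\<^sub>R B v w = B (v + w) (v + w) - B (v - w) (v - w)"
    unfolding bilinear_expand[OF B] sym[of w v] by norm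
  then have "4 * norm (B v w) = norm (B (v + w) (v + w) - B (v - w) (v - w))"
    by (metis abs_numeral norm_scaleR)
  also have "\<dots> \<le> c * (norm (v + w))\<^sup>2 + c * (norm (v - w))\<^sup>2"
    using bound[of "v + w"] bound[of "v - w"] norm_triangle_ineq4 by (smt (verit))
  also have "\<dots> = c * (2 * (norm v)\<^sup>2 + 2 * (norm w)\<^sup>2)"
    by (simp add: power2_norm_eq_inner inner_simps inner_commute algebra_simps)
  finally show ?thesis by (simp add: field_simps)
qed

text \<open>Stability by induction on the norm, without locating roots: the bound
  \<open>2 * M + \<rho>\<close> reproduces itself.\<close>

lemma bdf4_recurrence_stable:
  fixes b :: "nat \<Rightarrow> 'z::real_normed_vector"
  assumes M: "norm (b 0) \<le> M" "norm (b 1) \<le> M" "norm (b 2) \<le> M"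
    and step: "\<And>k. k + 3 \<le> N \<Longrightarrow>
      norm (25 *\<^sub>R b (k + 3) - 23 *\<^sub>R b (k + 2) + 13 *\<^sub>R b (k + 1) - 3 *\<^sub>R b k) \<le> \<rho>"
    and \<rho>: "0 \<le> \<rho>" and "n \<le> N"
  shows "norm (b n) \<le> 2 * M + \<rho>"
  using \<open>n \<le> N\<close>
proof (induction n rule: less_induct)
  case (less n)
  have M0: "0 \<le> M" using M(1) norm_ge_zero order_trans by blast
  have "n < 3 \<or> n = 3 \<or> (\<exists>m. n = m + 4)" by presburger
  then consider "n < 3" | "n = 3" | m where "n = m + 4" by blast
  then show ?case
  proof cases
    case 1
    then have "n = 0 \<or> n = 1 \<or> n = 2" by auto
    then show ?thesis using M M0 \<rho> by auto
  next
    case 2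
    \<comment> \<open>The later elimination takes two instances of \<open>step\<close>, so index 3
      is separate. Since 23 + 13 + 3 = 39 lies between 25 and 50, the bound has
      \<open>2 * M\<close>.\<close>
    have "norm (25 *\<^sub>R b 3 - 23 *\<^sub>R b 2 + 13 *\<^sub>R b 1 - 3 *\<^sub>R b 0) \<le> \<rho>"
      using step[of 0] less.prems 2 by (simp add: numeral_2_eq_2)
    then have "norm (25 *\<^sub>R b 3) \<le> \<rho> + (norm (23 *\<^sub>R b 2) + norm (13 *\<^sub>R b 1) + norm (3 *\<^sub>R b 0))"
      by norm
    then have "25 * norm (b 3) \<le> \<rho> + 39 * M" using M by simp
    then show ?thesis using 2 M0 \<rho> by simp
  next
    case 3
    have triangle: "norm (v + w + x - y + z) \<le> norm v + norm w + norm x + norm y + norm z"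
      for v w x y z :: 'z by norm
    let ?L = "2 * M + \<rho>"
    \<comment> \<open>The coefficients 23, 13, 3 have sum greater than 25, so one step does not contract.
      Eliminating \<open>b (m + 3)\<close> with the preceding instance leaves 204, 224, 69, with sum less than 625.\<close>
    define r where "r k = 25 *\<^sub>R b (k + 3) - 23 *\<^sub>R b (k + 2) + 13 *\<^sub>R b (k + 1) - 3 *\<^sub>R b k" for k
    have r: "norm (r (m + 1)) \<le> \<rho>" "norm (r m) \<le> \<rho>"
      using step[of "m + 1"] step[of m] less.prems 3 unfolding r_def by simp_all
    have IH: "norm (b (m + 2)) \<le> ?L" "norm (b (m + 1)) \<le> ?L" "norm (b m) \<le> ?L"
      using less 3 by simp_all
    have idx: "m + 1 + 3 = m + 4" "m + 1 + 2 = m + 3" "m + 1 + 1 = m + 2" by simp_all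
    have "625 *\<^sub>R b (m + 4) = 25 *\<^sub>R r (m + 1) + 23 *\<^sub>R r m
        + 204 *\<^sub>R b (m + 2) - 224 *\<^sub>R b (m + 1) + 69 *\<^sub>R b m"
      unfolding r_def idx by norm
    then have "norm (625 *\<^sub>R b (m + 4)) \<le> norm (25 *\<^sub>R r (m + 1)) + norm (23 *\<^sub>R r m)
        + norm (204 *\<^sub>R b (m + 2)) + norm (224 *\<^sub>R b (m + 1)) + norm (69 *\<^sub>R b m)"
      by (simp only: triangle)
    \<comment> \<open>48 = 25 + 23 and 497 = 204 + 224 + 69; the gap 625 - 497 absorbs the
      48.\<close>
    then have "625 * norm (b (m + 4)) \<le> 48 * \<rho> + 497 * ?L"
      using r IH unfolding norm_scaleR abs_numeral by auto
    then show ?thesis using 3 M0 \<rho> by simp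
  qed
qed

section \<open>Undivided backward differences\<close>

lemma scaleR_bdiff_Suc:
  assumes "s \<noteq> 0"
  shows "s ^ Suc j *\<^sub>R bdiff s v0 u (Suc j) (Suc n) =
    s ^ j *\<^sub>R bdiff s v0 u j (Suc n) - s ^ j *\<^sub>R bdiff s v0 u j n"
proof -
  have "s ^ Suc j * inverse s = s ^ j"
    using assms by simp
  then show ?thesis
    by (simp add: scaleR_diff_right del: power_Suc)
qed

lemma scaleR_bdiff1:
  assumes "s \<noteq> 0"
  shows "s *\<^sub>R bdiff s v0 u 1 (Suc n) = u (Suc n) - u n"
  using scaleR_bdiff_Suc[OF assms, of 0 v0 u n] by (simp del: bdiff.simps(2-))

lemma scaleR_bdiff2_Suc:
  assumes "s \<noteq> 0"
  shows "s\<^sup>2 *\<^sub>R bdiff s v0 u 2 (Suc n) = s *\<^sub>R bdiff s v0 u 1 (Suc n) - s *\<^sub>R bdiff s v0 u 1 n"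
  using scaleR_bdiff_Suc[OF assms, of 1 v0 u n] unfolding power_one_right Suc_1 .

text \<open>The zero initial velocity turns the first increment into a second difference at index 1,
  so the maximum over \<open>n >= 1\<close> controls it.\<close>

lemma scaleR_bdiff2_1:
  assumes "s \<noteq> 0" and "bdiff s v0 u 1 0 = 0"
  shows "s\<^sup>2 *\<^sub>R bdiff s v0 u 2 1 = u 1 - u 0"
  using scaleR_bdiff2_Suc[OF assms(1), of v0 u 0] scaleR_bdiff1[OF assms(1), of v0 u 0]
  unfolding One_nat_def[symmetric] assms(2) by simp

lemma scaleR_bdiff2:
  assumes "s \<noteq> 0"
  shows "s\<^sup>2 *\<^sub>R bdiff s v0 u 2 (n + 2) = u (n + 2) - 2 *\<^sub>R u (n + 1) + u n"
proof -
  have "s\<^sup>2 *\<^sub>R bdiff s v0 u 2 (Suc (Suc n)) = u (Suc (Suc n)) - u (Suc n) - (u (Suc n) - u n)"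
    unfolding scaleR_bdiff2_Suc[OF assms] scaleR_bdiff1[OF assms] ..
  then show ?thesis
    by (simp add: scaleR_2 del: bdiff.simps)
qed

text \<open>From index 3 on, a third difference reaches neither \<open>v0\<close> nor the
  unspecified \<open>bdiff s v0 u 2 0\<close>.\<close>

lemma scaleR_bdiff3:
  assumes "s \<noteq> 0"
  shows "s ^ 3 *\<^sub>R bdiff s v0 u 3 (n + 3) = u (n + 3) - 3 *\<^sub>R u (n + 2) + 3 *\<^sub>R u (n + 1) - u n"
proof -
  have "s ^ 3 *\<^sub>R bdiff s v0 u 3 (n + 3) =
      s\<^sup>2 *\<^sub>R bdiff s v0 u 2 (n + 1 + 2) - s\<^sup>2 *\<^sub>R bdiff s v0 u 2 (n + 2)"
    using scaleR_bdiff_Suc[OF assms, of 2 v0 u "n + 2"]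
    by (simp add: numeral_3_eq_3 numeral_2_eq_2 del: bdiff.simps(2-) power_Suc)
  moreover have "n + 1 + 2 = n + 3" "n + 1 + 1 = n + 2"
    by simp_all
  moreover have "u (n + 3) - 2 *\<^sub>R u (n + 2) + u (n + 1) - (u (n + 2) - 2 *\<^sub>R u (n + 1) + u n) =
      u (n + 3) - 3 *\<^sub>R u (n + 2) + 3 *\<^sub>R u (n + 1) - u n"
    by (simp add: algebra_simps scaleR_2 scaleR_left_distrib[of 1 2, simplified])
  ultimately show ?thesis
    unfolding scaleR_bdiff2[OF assms] by (simp only:)
qed


section \<open>Drift of the constraint for a fixed step size\<close>

lemma bdf4_constraint_drift:
  fixes B :: "'u::real_normed_vector \<Rightarrow> 'u \<Rightarrow> 'z::real_normed_vector"
  assumes B: "bilinear B" and sym: "\<And>v w. B v w = B w v"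
    and "0 \<le> K" and K: "\<And>v w. norm (B v w) \<le> K * ((norm v)\<^sup>2 + (norm w)\<^sup>2)"
    and s: "s > 0" and v0: "bdiff s v0 u 1 0 = 0"
    and bdf4: "\<And>n. n \<ge> 4 \<Longrightarrow> bdf_constraint B 4 s u n"
    and bdf_start: "\<And>p. p \<in> {1, 2, 3} \<Longrightarrow> bdf_constraint B p s u p"
    and N: "N \<ge> 4"
  defines "b \<equiv> \<lambda>n. B (u n) (u n)"
  defines "X \<equiv> s ^ 6 * (\<Sum>n=3..N. (norm (bdiff s v0 u 3 n))\<^sup>2)
    + s ^ 4 * (MAX n\<in>{1..N-1}. (norm (bdiff s v0 u 2 n))\<^sup>2)"
  shows "norm (b N - b 0) \<le> 610 * K * X"
proof -
  \<comment> \<open>Here \<open>E k\<close> and \<open>F k\<close> are the differences at the indices \<open>k + 2\<close> and \<open>k + 3\<close>.\<close>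
  define E where "E k = u (k + 2) - 2 *\<^sub>R u (k + 1) + u k" for k
  define F where "F k = u (k + 3) - 3 *\<^sub>R u (k + 2) + 3 *\<^sub>R u (k + 1) - u k" for k
  define S where "S m = (\<Sum>k\<le>m. (norm (F k))\<^sup>2)" for m
  define m where "m = s ^ 4 * (MAX n\<in>{1..N-1}. (norm (bdiff s v0 u 2 n))\<^sup>2)"
  have s0: "s \<noteq> 0" using s by simp
  have max: "(norm (s\<^sup>2 *\<^sub>R bdiff s v0 u 2 n))\<^sup>2 \<le> m" if "n \<in> {1..N-1}" for n
  proof -
    have "(norm (bdiff s v0 u 2 n))\<^sup>2 \<le> (MAX n\<in>{1..N-1}. (norm (bdiff s v0 u 2 n))\<^sup>2)"
      using that by (intro Max_ge) auto
    then have "s ^ 4 * (norm (bdiff s v0 u 2 n))\<^sup>2 \<le> m"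
      unfolding m_def using s by (intro mult_left_mono) auto
    then show ?thesis
      by (simp add: power_mult_distrib flip: power_mult del: bdiff.simps)
  qed
  have e1: "(norm (u 1 - u 0))\<^sup>2 \<le> m"
    using max[of 1] N unfolding scaleR_bdiff2_1[OF s0 v0] by auto
  \<comment> \<open>\<open>E k\<close> sits at index \<open>k + 2\<close> and the maximum ends at
    \<open>N - 1\<close>, hence the condition on \<open>k\<close>.\<close>
  have E: "(norm (E k))\<^sup>2 \<le> m" if "k + 3 \<le> N" for k
    using max[of "k + 2"] that unfolding scaleR_bdiff2[OF s0] E_def by auto
  have m0: "0 \<le> m"
    using e1 zero_le_power2 order_trans by blast
  have F: "(norm (F k))\<^sup>2 = s ^ 6 * (norm (bdiff s v0 u 3 (k + 3)))\<^sup>2" for k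
    unfolding F_def scaleR_bdiff3[OF s0, of v0 u k, symmetric]
    using s by (simp add: power_mult_distrib flip: power_mult del: bdiff.simps)
  have "S (N - 3) = s ^ 6 * (\<Sum>k\<le>N - 3. (norm (bdiff s v0 u 3 (k + 3)))\<^sup>2)"
    unfolding S_def F sum_distrib_left ..
  also have "(\<Sum>k\<le>N - 3. (norm (bdiff s v0 u 3 (k + 3)))\<^sup>2) = (\<Sum>n=3..N. (norm (bdiff s v0 u 3 n))\<^sup>2)"
    by (rule sum.reindex_bij_witness[of _ "\<lambda>n. n - 3" "\<lambda>k. k + 3"]) (use N in auto)
  finally have X: "X = S (N - 3) + m"
    unfolding X_def m_def by simp
  have S_mono: "S j \<le> S (N - 3)" if "j + 3 \<le> N" for j
    unfolding S_def using that by (intro sum_mono2) auto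
  have S0: "0 \<le> S j" for j
    unfolding S_def by (intro sum_nonneg) auto
  have F0: "(norm (F 0))\<^sup>2 \<le> S (N - 3)"
    using S_mono[of 0] N by (simp add: S_def)
  have Q: "norm (B v v) \<le> 2 * K * r" if "(norm v)\<^sup>2 \<le> r" for v r
  proof -
    have "norm (B v v) \<le> 2 * K * (norm v)\<^sup>2" using K[of v v] by simp
    also have "\<dots> \<le> 2 * K * r" using that \<open>0 \<le> K\<close> by (intro mult_left_mono) auto
    finally show ?thesis .
  qed
  have QE0: "norm (B (E 0) (E 0)) \<le> 2 * K * m"
    using Q E[of 0] N by simp
  have QF0: "norm (B (F 0) (F 0)) \<le> 2 * K * S (N - 3)"
    using Q F0 by simp
  have b1: "norm (b 1 - b 0) \<le> 2 * K * m"
    unfolding b_def using bdf1_constraint_expansion[OF B sym s0 bdf_start[of 1]] Q[OF e1] by simp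
  have b2: "3 * norm (b 2 - b 0) \<le> 14 * K * m"
  proof -
    have E0: "u 2 - 2 *\<^sub>R u 1 + u 0 = E 0"
      unfolding E_def by (simp add: eval_nat_numeral)
    have "3 *\<^sub>R b 2 - 4 *\<^sub>R b 1 + b 0 = 3 *\<^sub>R B (E 0) (E 0)"
      using bdf2_constraint_expansion[OF B sym s0 bdf_start[of 2]] unfolding E0 b_def by simp
    \<comment> \<open>The coefficients 3, -4, 1 sum to zero, so \<open>b\<close> may be replaced by
      its deviation from \<open>b 0\<close>.\<close>
    moreover have "3 *\<^sub>R (b 2 - b 0) = 4 *\<^sub>R (b 1 - b 0) + (3 *\<^sub>R b 2 - 4 *\<^sub>R b 1 + b 0)"
      by norm
    ultimately have "norm (3 *\<^sub>R (b 2 - b 0)) \<le> norm (4 *\<^sub>R (b 1 - b 0)) + norm (3 *\<^sub>R B (E 0) (E 0))"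
      using norm_triangle_ineq by metis
    then show ?thesis
      using b1 QE0 unfolding norm_scaleR by linarith
  qed
  have b3: "11 * norm (b 3 - b 0) \<le> 120 * K * m + 22 * K * S (N - 3)"
  proof -
    have EF: "u 2 - 2 *\<^sub>R u 1 + u 0 = E 0" "u 3 - 3 *\<^sub>R u 2 + 3 *\<^sub>R u 1 - u 0 = F 0"
      unfolding E_def F_def by (simp_all add: eval_nat_numeral)
    have "11 *\<^sub>R b 3 - 18 *\<^sub>R b 2 + 9 *\<^sub>R b 1 - 2 *\<^sub>R b 0 = 11 *\<^sub>R B (F 0) (F 0) - 9 *\<^sub>R B (E 0) (E 0)"
      using bdf3_constraint_expansion[OF B sym s0 bdf_start[of 3]] unfolding EF b_def by simp
    moreover have "11 *\<^sub>R (b 3 - b 0) = 18 *\<^sub>R (b 2 - b 0) - 9 *\<^sub>R (b 1 - b 0)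
        + (11 *\<^sub>R b 3 - 18 *\<^sub>R b 2 + 9 *\<^sub>R b 1 - 2 *\<^sub>R b 0)"
      by norm
    ultimately have "11 *\<^sub>R (b 3 - b 0) = 18 *\<^sub>R (b 2 - b 0) - 9 *\<^sub>R (b 1 - b 0)
        + (11 *\<^sub>R B (F 0) (F 0) - 9 *\<^sub>R B (E 0) (E 0))"
      by simp
    then have "norm (11 *\<^sub>R (b 3 - b 0)) \<le> norm (18 *\<^sub>R (b 2 - b 0)) + norm (9 *\<^sub>R (b 1 - b 0))
        + (norm (11 *\<^sub>R B (F 0) (F 0)) + norm (9 *\<^sub>R B (E 0) (E 0)))"
      by (smt (verit) norm_triangle_ineq norm_triangle_ineq4)
    then show ?thesis
      using b1 b2 QE0 QF0 unfolding norm_scaleR by linarith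
  qed
  \<comment> \<open>The cubic factor applied to the deviation from \<open>b 0\<close>. The split-off
    factor \<zeta> - 1 makes \<open>r (Suc j) - r j\<close> the full BDF-4 combination, where
    \<open>b 0\<close> cancels.\<close>
  define r where
    "r k = 25 *\<^sub>R (b (k + 3) - b 0) - 23 *\<^sub>R (b (k + 2) - b 0) + 13 *\<^sub>R (b (k + 1) - b 0) - 3 *\<^sub>R (b k - b 0)" for k
  have r0: "norm (r 0) \<le> 410 * K * m + 50 * K * S (N - 3)"
  proof -
    have "r 0 = 25 *\<^sub>R (b 3 - b 0) - 23 *\<^sub>R (b 2 - b 0) + 13 *\<^sub>R (b 1 - b 0)"
      unfolding r_def by (simp add: eval_nat_numeral)
    then have "norm (r 0) \<le> norm (25 *\<^sub>R (b 3 - b 0)) + norm (23 *\<^sub>R (b 2 - b 0))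
        + norm (13 *\<^sub>R (b 1 - b 0))"
      by (smt (verit) norm_triangle_ineq norm_triangle_ineq4)
    moreover have "0 \<le> K * m" using \<open>0 \<le> K\<close> m0 by simp
    ultimately show ?thesis
      using b1 b2 b3 unfolding norm_scaleR by linarith
  qed
  \<comment> \<open>In units of \<open>K\<close>, one step charges 100 to the square of
    \<open>F (Suc j)\<close> and 80 to that of \<open>F j\<close>, in total 180 for each. The extra
    term on the left reserves the 80 that the next step will charge to \<open>F j\<close>.\<close>
  have telescoped: "norm (r j + 24 *\<^sub>R B (E j) (E j) - (r 0 + 24 *\<^sub>R B (E 0) (E 0))) + 80 * K * (norm (F j))\<^sup>2
      \<le> 180 * K * S j" for j
  proof (induction j)
    case 0
    show ?case using \<open>0 \<le> K\<close> by (simp add: S_def mult_right_mono)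
  next
    case (Suc j)
    define R where "R = 25 *\<^sub>R B (F (Suc j)) (F (Suc j)) - 50 *\<^sub>R B (F (Suc j)) (F j) - 15 *\<^sub>R B (F j) (F j)"
    have "25 *\<^sub>R b (j + 4) - 48 *\<^sub>R b (j + 3) + 36 *\<^sub>R b (j + 2) - 16 *\<^sub>R b (j + 1) + 3 *\<^sub>R b j =
        24 *\<^sub>R B (E j) (E j) - 24 *\<^sub>R B (E (Suc j)) (E (Suc j)) + R"
      using bdf4_constraint_expansion[OF B sym s0 bdf4[of "j + 4"]]
      unfolding b_def E_def F_def R_def by simp
    moreover have "r (Suc j) - r j =
        25 *\<^sub>R b (j + 4) - 48 *\<^sub>R b (j + 3) + 36 *\<^sub>R b (j + 2) - 16 *\<^sub>R b (j + 1) + 3 *\<^sub>R b j"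
    proof -
      have idx: "Suc j = j + 1" "j + 1 + 3 = j + 4" "j + 1 + 2 = j + 3" "j + 1 + 1 = j + 2"
        by simp_all
      show ?thesis unfolding r_def idx by norm
    qed
    ultimately have "r (Suc j) - r j = 24 *\<^sub>R B (E j) (E j) - 24 *\<^sub>R B (E (Suc j)) (E (Suc j)) + R"
      by simp
    then have "r (Suc j) + 24 *\<^sub>R B (E (Suc j)) (E (Suc j)) - (r 0 + 24 *\<^sub>R B (E 0) (E 0)) =
        r j + 24 *\<^sub>R B (E j) (E j) - (r 0 + 24 *\<^sub>R B (E 0) (E 0)) + R"
      by (simp add: algebra_simps)
    then have "norm (r (Suc j) + 24 *\<^sub>R B (E (Suc j)) (E (Suc j)) - (r 0 + 24 *\<^sub>R B (E 0) (E 0))) \<le>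
        norm (r j + 24 *\<^sub>R B (E j) (E j) - (r 0 + 24 *\<^sub>R B (E 0) (E 0))) + norm R"
      by (metis norm_triangle_ineq)
    moreover have "norm R \<le> norm (25 *\<^sub>R B (F (Suc j)) (F (Suc j))) + norm (50 *\<^sub>R B (F (Suc j)) (F j))
        + norm (15 *\<^sub>R B (F j) (F j))"
      unfolding R_def by norm
    then have "norm R \<le> 100 * (K * (norm (F (Suc j)))\<^sup>2) + 80 * (K * (norm (F j))\<^sup>2)"
      using K[of "F (Suc j)" "F (Suc j)"] K[of "F (Suc j)" "F j"] K[of "F j" "F j"]
      unfolding norm_scaleR distrib_left by linarith
    moreover have S_Suc: "K * S (Suc j) = K * S j + K * (norm (F (Suc j)))\<^sup>2"
      by (simp add: S_def distrib_left)
    ultimately show ?case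
      using Suc.IH S_Suc unfolding mult.assoc by linarith
  qed
  \<comment> \<open>In units of \<open>K\<close>, the contributions are 506 for \<open>m\<close> and
    230 for \<open>S (N - 3)\<close>; 600 is a round upper bound.\<close>
  have r: "norm (r j) \<le> 600 * K * X" if j: "j + 3 \<le> N" for j
  proof -
    have "norm (r j) \<le> norm (r j + 24 *\<^sub>R B (E j) (E j) - (r 0 + 24 *\<^sub>R B (E 0) (E 0)))
        + (norm (r 0) + norm (24 *\<^sub>R B (E 0) (E 0)) + norm (24 *\<^sub>R B (E j) (E j)))"
      by norm
    moreover have "0 \<le> K * (norm (F j))\<^sup>2" "0 \<le> K * m" "0 \<le> K * S (N - 3)" "K * S j \<le> K * S (N - 3)"
      using \<open>0 \<le> K\<close> m0 S0 S_mono[OF j] by (simp_all add: mult_left_mono)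
    ultimately show ?thesis
      using telescoped[of j] r0 QE0 Q[OF E[OF j]]
      unfolding norm_scaleR X distrib_left mult.assoc by linarith
  qed
  have X0: "0 \<le> K * m" "0 \<le> K * S (N - 3)" "K * X = K * S (N - 3) + K * m"
    using \<open>0 \<le> K\<close> m0 S0 by (simp_all add: X distrib_left)
  have "norm (b N - b 0) \<le> 2 * (5 * K * X) + 600 * K * X"
  proof (rule bdf4_recurrence_stable[where b = "\<lambda>n. b n - b 0" and N = N])
    show "norm (b 0 - b 0) \<le> 5 * K * X" "norm (b 1 - b 0) \<le> 5 * K * X"
      "norm (b 2 - b 0) \<le> 5 * K * X" "0 \<le> 600 * K * X"
      using X0 b1 b2 unfolding mult.assoc by simp_all
  qed (use r in \<open>simp_all add: r_def\<close>)
  then show ?thesis by simp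
qed

section \<open>Constants uniform in the step size\<close>

theorem corollary3p7:
  fixes B :: "'u::{real_inner, banach} \<Rightarrow> 'u \<Rightarrow> 'z::real_normed_vector"
    and c_Z :: real
    and u_c :: 'z
    and u :: "real \<Rightarrow> nat \<Rightarrow> 'u"
    and v0 :: "real \<Rightarrow> 'u"
  assumes bilinear: "bilinear B"
    and symmetric: "\<And>v w. B v w = B w v"
    and bound: "\<And>v. norm (B v v) \<le> c_Z * (norm v)\<^sup>2"
    and velocity0: "\<And>s. s > 0 \<Longrightarrow> bdiff s (v0 s) (u s) 1 0 = 0"
    and constraint0: "\<And>s. s > 0 \<Longrightarrow> B (u s 0) (u s 0) = u_c"
    and bdf4: "\<And>s n. s > 0 \<Longrightarrow> n \<ge> 4 \<Longrightarrow> bdf_constraint B 4 s (u s) n"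
    and bdf_start: "\<And>s p. s > 0 \<Longrightarrow> p \<in> {1, 2, 3} \<Longrightarrow> bdf_constraint B p s (u s) p"
  shows "(\<exists>C>0. \<forall>s>0. \<forall>N\<ge>4.
            norm (B (u s N) (u s N) - u_c)
              \<le> C * (s ^ 6 * (\<Sum>n=3..N. (norm (bdiff s (v0 s) (u s) 3 n))\<^sup>2)
                     + s ^ 4 * (MAX n\<in>{1..N-1}. (norm (bdiff s (v0 s) (u s) 2 n))\<^sup>2)))
       \<and> ((\<exists>C\<^sub>0>0. \<forall>s>0. \<forall>N\<ge>4.
              (\<Sum>n=3..N. s\<^sup>2 * (norm (bdiff s (v0 s) (u s) 3 n))\<^sup>2) \<le> C\<^sub>0
              \<and> (MAX n\<in>{1..N-1}. (norm (bdiff s (v0 s) (u s) 2 n))\<^sup>2) \<le> C\<^sub>0)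
          \<longrightarrow> (\<exists>C'>0. \<forall>s>0. \<forall>N\<ge>4. norm (B (u s N) (u s N) - u_c) \<le> C' * s ^ 4))"
proof -
  \<comment> \<open>The summand 1 keeps \<open>K\<close> positive whatever the sign of
    \<open>c_Z\<close>.\<close>
  define K where "K = \<bar>c_Z\<bar> + 1"
  let ?X = "\<lambda>s N. s ^ 6 * (\<Sum>n=3..N. (norm (bdiff s (v0 s) (u s) 3 n))\<^sup>2)
    + s ^ 4 * (MAX n\<in>{1..N-1}. (norm (bdiff s (v0 s) (u s) 2 n))\<^sup>2)"
  have K: "norm (B v w) \<le> K * ((norm v)\<^sup>2 + (norm w)\<^sup>2)" for v w
  proof -
    have "norm (B v w) \<le> (c_Z / 2) * ((norm v)\<^sup>2 + (norm w)\<^sup>2)"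
      using bilinear_quadratic_bound[OF bilinear symmetric bound, of v w] by simp
    also have "\<dots> \<le> K * ((norm v)\<^sup>2 + (norm w)\<^sup>2)"
      unfolding K_def by (intro mult_right_mono) auto
    finally show ?thesis .
  qed
  have "0 < K"
    unfolding K_def by simp
  have main: "norm (B (u s N) (u s N) - u_c) \<le> 610 * K * ?X s N" if "s > 0" "N \<ge> 4" for s N
    using bdf4_constraint_drift[OF bilinear symmetric _ K \<open>s > 0\<close> velocity0 bdf4 bdf_start \<open>N \<ge> 4\<close>]
      that \<open>0 < K\<close> unfolding constraint0[OF \<open>s > 0\<close>] by simp
  show ?thesis
  proof (intro conjI impI)
    show "\<exists>C>0. \<forall>s>0. \<forall>N\<ge>4. norm (B (u s N) (u s N) - u_c) \<le> C * ?X s N"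
      using main \<open>0 < K\<close> by (intro exI[of _ "610 * K"]) simp
  next
    assume "\<exists>C\<^sub>0>0. \<forall>s>0. \<forall>N\<ge>4.
      (\<Sum>n=3..N. s\<^sup>2 * (norm (bdiff s (v0 s) (u s) 3 n))\<^sup>2) \<le> C\<^sub>0
      \<and> (MAX n\<in>{1..N-1}. (norm (bdiff s (v0 s) (u s) 2 n))\<^sup>2) \<le> C\<^sub>0"
    then obtain C0 where "C0 > 0" and C0: "\<And>s N. s > 0 \<Longrightarrow> N \<ge> 4 \<Longrightarrow>
        (\<Sum>n=3..N. s\<^sup>2 * (norm (bdiff s (v0 s) (u s) 3 n))\<^sup>2) \<le> C0
        \<and> (MAX n\<in>{1..N-1}. (norm (bdiff s (v0 s) (u s) 2 n))\<^sup>2) \<le> C0"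
      by blast
    have "norm (B (u s N) (u s N) - u_c) \<le> 1220 * K * C0 * s ^ 4" if "s > 0" "N \<ge> 4" for s N
    proof -
      \<comment> \<open>Splitting s^6 into s^4 and s^2 exposes the weighted sum of the assumption;
        both summands are then at most \<open>C0\<close>, whence 1220 = 2 * 610.\<close>
      have "?X s N = s ^ 4 * ((\<Sum>n=3..N. s\<^sup>2 * (norm (bdiff s (v0 s) (u s) 3 n))\<^sup>2)
          + (MAX n\<in>{1..N-1}. (norm (bdiff s (v0 s) (u s) 2 n))\<^sup>2))"
        by (simp add: distrib_left sum_distrib_left mult.assoc[symmetric] del: bdiff.simps
            flip: power_add)
      also have "\<dots> \<le> s ^ 4 * (C0 + C0)"
        using C0[OF that] that by (intro mult_left_mono add_mono) auto
      finally have "610 * K * ?X s N \<le> 610 * K * (s ^ 4 * (C0 + C0))"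
        using \<open>0 < K\<close> by (intro mult_left_mono) auto
      then show ?thesis
        using main[OF that] by (simp add: algebra_simps del: bdiff.simps)
    qed
    then show "\<exists>C'>0. \<forall>s>0. \<forall>N\<ge>4. norm (B (u s N) (u s N) - u_c) \<le> C' * s ^ 4"
      using \<open>0 < K\<close> \<open>C0 > 0\<close> by (intro exI[of _ "1220 * K * C0"]) simp
  qed
qed

end
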